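(* There exists a family of statistics $\tau=(\tau_n)_{n\ge1}$, $\tau_n:\{0,1\}^n\to\mathbb{R}$, such that for every stationary ergodic probability measure $\nu$ on infinite binary sequences, with $\nu$-probability $1$, $$\lim_{n\to\infty} -\frac{1}{n}\log_2 \pi_{\tau}(x_1\ldots x_n) = 1-h(\nu),$$ where $h(\nu)$ is the Shannon entropy (entropy rate) of $\nu$ and $$\pi_\tau(x_1\ldots x_n)=\frac{\bigl|\{\,y\in\{0,1\}^n:\tau_n(y)>\tau_n(x_1\ldots x_n)\,\}\bigr|}{2^n}.$$
   Context: $\pi_\tau$ is the p-value of the test based on statistic $\tau$ for the null hypothesis that $x_1\ldots x_n$ is uniformly distributed on $\{0,1\}^n$. Logarithms are base 2; $h(\nu)=\lim_{n\to\infty}-\frac1n\sum_{x\in\{0,1\}^n}\nu(x)\log_2\nu(x)$. (In the paper the statistic is $\tau_n(x_1\ldots x_n)=n-|\phi(x_1\ldots x_n)|$, where $\phi$ is a universal code: for each $m$, $\phi$ is an injective map $\{0,1\}^m\to\bigcup_{i\ge1}\{0,1\}^i$ with $\sum_{u\in\{0,1\}^m}2^{-|\phi(u)|}=1$, and for every stationary ergodic $\nu$, $\frac1n|\phi(x_1\ldots x_n)|\to h(\nu)$ with $\nu$-probability 1.) *)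

theory Defs
  imports "HOL-Probability.Probability"
begin

definition seq_space :: "(nat \<Rightarrow> bool) measure" where
  "seq_space = PiM UNIV (\<lambda>_. count_space UNIV)"

definition shift :: "(nat \<Rightarrow> bool) \<Rightarrow> (nat \<Rightarrow> bool)" where
  "shift \<omega> = (\<lambda>i. \<omega> (Suc i))"

definition stationary :: "(nat \<Rightarrow> bool) measure \<Rightarrow> bool" where
  "stationary M \<longleftrightarrow> prob_space M \<and> sets M = sets seq_space \<and>
     shift \<in> measurable M M \<and> distr M M shift = M"

definition ergodic :: "(nat \<Rightarrow> bool) measure \<Rightarrow> bool" where
  "ergodic M \<longleftrightarrow> (\<forall>A \<in> sets M. shift -` A \<inter> space M = A \<longrightarrow>
       measure M A = 0 \<or> measure M A = 1)"

definition prefix :: "nat \<Rightarrow> (nat \<Rightarrow> bool) \<Rightarrow> bool list" where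
  "prefix n \<omega> = map \<omega> [0..<n]"

definition word_prob :: "(nat \<Rightarrow> bool) measure \<Rightarrow> bool list \<Rightarrow> real" where
  "word_prob M x = measure M {\<omega> \<in> space M. prefix (length x) \<omega> = x}"

definition entropy_rate :: "(nat \<Rightarrow> bool) measure \<Rightarrow> real" where
  "entropy_rate M = lim (\<lambda>n. - (1 / real n) *
      (\<Sum>x \<in> {x :: bool list. length x = n}. word_prob M x * log 2 (word_prob M x)))"

definition pval :: "(nat \<Rightarrow> bool list \<Rightarrow> real) \<Rightarrow> bool list \<Rightarrow> real" where
  "pval \<tau> x = real (card {y :: bool list. length y = length x \<and>
       \<tau> (length x) y > \<tau> (length x) x}) / 2 ^ length x"

end

theory Submission
  imports Defs "HOL-Real_Asymp.Real_Asymp"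
begin

text \<open>
  The statistic ranks words of length \<open>n\<close> by a mixture of countably many Markov measures with
  rational parameters, ties being broken injectively. If \<open>N\<close> words rank above \<open>x\<close>, then \<open>N\<close> times
  the weight of \<open>x\<close> is at most the total mass, so \<open>log N\<close> is at most the ideal code length of \<open>x\<close>
  under each of these Markov measures up to \<open>o(n)\<close>; by the ergodic theorem for the (bounded) losses
  this gives the rate at most the infimum of the expected losses, which is the entropy rate.
  Conversely the rank is injective, so Borel--Cantelli gives the rate at least the entropy rate once
  \<open>\<nu>(x\<^sub>1\<dots>x\<^sub>n) < 2 powr (-(c * n))\<close> is known eventually for every \<open>c\<close> below it (one half of the
  Shannon--McMillan--Breiman theorem). This and the one-sided ergodic theorem both follow from one
  covering argument: if a nonnegative superadditive process is infinitely often at least \<open>a * n\<close>,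
  greedily cutting a long sample path into such blocks shows that its mean grows at least like \<open>a * n\<close>.
\<close>

subsection \<open>Superadditive processes\<close>

text \<open>Greedy cutting: outside \<open>B\<close> the path advances by a block of length at most
  \<open>K\<close> that earns \<open>a\<close> per step; inside \<open>B\<close> it advances by one
  step. What is lost is \<open>a\<close> for every visit to \<open>B\<close> and at most
  \<open>a * K\<close> for the final stretch, where a block need not fit.\<close>

lemma superadditive_lower_bound:
  fixes F :: "nat \<Rightarrow> 'a \<Rightarrow> real" and T :: "'a \<Rightarrow> 'a"
  assumes nonneg: "\<And>n \<omega>. 0 \<le> F n \<omega>"
    and super: "\<And>m n \<omega>. F m \<omega> + F n ((T ^^ m) \<omega>) \<le> F (m + n) \<omega>"
    and a: "0 \<le> a"
    and B: "\<And>\<omega>. \<omega> \<notin> B \<Longrightarrow> \<exists>n\<in>{1..K}. a * real n \<le> F n \<omega>"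
  shows "a * (real N - real K - (\<Sum>i<N. indicator B ((T ^^ i) \<omega>))) \<le> F N \<omega>"
proof (induction N arbitrary: \<omega> rule: less_induct)
  case (less N)
  define s where "s = (\<lambda>n \<omega>. \<Sum>i<n. indicator B ((T ^^ i) \<omega>) :: real)"
  have s_nonneg: "0 \<le> s n \<omega>" for n \<omega>
    unfolding s_def by (intro sum_nonneg) auto
  have s_add: "s (m + n) \<omega> = s m \<omega> + s n ((T ^^ m) \<omega>)" for m n \<omega>
    unfolding s_def
    by (induction n) (simp_all add: funpow_add add.commute)
  show ?case
  proof (cases "N \<le> K")
    case True
    then have "a * (real N - real K - s N \<omega>) \<le> 0"
      using a s_nonneg[of N \<omega>] by (intro mult_nonneg_nonpos) auto
    then show ?thesis using nonneg[of N \<omega>] by (simp add: s_def)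
  next
    case False
    \<comment> \<open>The first piece: a single step from a point of \<open>B\<close>, otherwise the
      block given by the assumption on \<open>B\<close>, which fits because
      \<open>K < N\<close>.\<close>
    obtain n where n: "1 \<le> n" "n \<le> N" and Fn: "a * (real n - s n \<omega>) \<le> F n \<omega>"
    proof (cases "\<omega> \<in> B")
      case True
      show ?thesis
        using that[of 1] False True nonneg[of 1 \<omega>] by (simp add: s_def)
    next
      assume "\<omega> \<notin> B"
      then obtain n where n: "n \<in> {1..K}" "a * real n \<le> F n \<omega>" using B by blast
      have "a * (real n - s n \<omega>) \<le> a * real n"
        using a s_nonneg[of n \<omega>] by (intro mult_left_mono) auto
      then show ?thesis using that[of n] n False by auto
    qed
    have "a * (real (N - n) - real K - s (N - n) ((T ^^ n) \<omega>)) \<le> F (N - n) ((T ^^ n) \<omega>)"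
      unfolding s_def using n by (intro less) auto
    moreover have "F n \<omega> + F (N - n) ((T ^^ n) \<omega>) \<le> F N \<omega>"
      using super[of n \<omega> "N - n"] n by simp
    moreover have "s N \<omega> = s n \<omega> + s (N - n) ((T ^^ n) \<omega>)"
      using s_add[of n "N - n"] n by simp
    ultimately have "a * (real N - real K - s N \<omega>) \<le> F N \<omega>"
      using Fn n by (simp only: of_nat_diff) (simp add: algebra_simps)
    then show ?thesis by (simp add: s_def)
  qed
qed

subsection \<open>Stationary sources\<close>

locale ergodic_source =
  fixes M :: "(nat \<Rightarrow> bool) measure"
  assumes stationary: "stationary M" and ergodic: "ergodic M"
begin

sublocale prob_space M
  using stationary by (simp add: stationary_def)

lemma sets_M: "sets M = sets seq_space"
  using stationary by (simp add: stationary_def)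

lemma space_M [simp]: "space M = UNIV"
  using sets_eq_imp_space_eq[OF sets_M] by (simp add: seq_space_def space_PiM)

lemma prob_UNIV [simp]: "prob UNIV = 1"
  using prob_space by simp

lemma shift_measurable [measurable]: "shift \<in> measurable M M"
  using stationary by (simp add: stationary_def)

lemma distr_shift: "distr M M shift = M"
  using stationary by (simp add: stationary_def)

lemma funpow_shift_measurable [measurable]: "(shift ^^ n) \<in> measurable M M"
proof (induction n)
  case (Suc n)
  then show ?case using measurable_comp[OF Suc shift_measurable] by (simp add: comp_def)
qed (simp add: id_def)

lemma distr_funpow_shift: "distr M M (shift ^^ n) = M"
proof (induction n)
  case 0
  then show ?case by (simp add: id_def distr_id)
next
  case (Suc n)
  have "distr M M (shift ^^ Suc n) = distr (distr M M (shift ^^ n)) M shift"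
    by (simp add: distr_distr)
  then show ?case by (simp add: Suc distr_shift comp_def)
qed

lemma integral_funpow_shift:
  fixes f :: "(nat \<Rightarrow> bool) \<Rightarrow> real"
  assumes [measurable]: "f \<in> borel_measurable M"
  shows "(\<integral>\<omega>. f ((shift ^^ n) \<omega>) \<partial>M) = (\<integral>\<omega>. f \<omega> \<partial>M)"
  using integral_distr[of "shift ^^ n" M M f] by (simp add: distr_funpow_shift)

lemma measure_vimage_funpow_shift:
  assumes [measurable]: "A \<in> sets M"
  shows "measure M ((shift ^^ n) -` A) = measure M A"
  using measure_distr[of "shift ^^ n" M M A] by (simp add: distr_funpow_shift)

text \<open>Integrating the pathwise bound turns the visits to the bad set \<open>B K\<close> into
  \<open>N * measure M (B K)\<close>, by stationarity. Almost every point has a good block, so this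
  measure vanishes as \<open>K\<close> grows; with \<open>K\<close> fixed, a large \<open>N\<close>
  then gives the claim.\<close>

lemma superadditive_mean_lower_bound:
  assumes [measurable]: "\<And>n. F n \<in> borel_measurable M"
    and nonneg: "\<And>n \<omega>. 0 \<le> F n \<omega>"
    and bounded: "\<And>n \<omega>. F n \<omega> \<le> C * real n"
    and super: "\<And>m n \<omega>. F m \<omega> + F n ((shift ^^ m) \<omega>) \<le> F (m + n) \<omega>"
    and a: "0 \<le> a"
    and large: "AE \<omega> in M. \<exists>n\<ge>1. a * real n \<le> F n \<omega>"
    and mean: "\<And>N. (\<integral>\<omega>. F N \<omega> \<partial>M) \<le> b * real N"
  shows "a \<le> b"
proof (rule ccontr)
  assume "\<not> a \<le> b"
  then have ba: "b < a" by simp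
  have intF: "integrable M (F n)" for n
    by (rule integrable_const_bound[where B="C * real n"])
      (auto simp: nonneg bounded abs_of_nonneg)
  have "0 \<le> b" using mean[of 1] Bochner_Integration.integral_nonneg[of M "F 1"] nonneg
    by fastforce
  with ba have a_pos: "0 < a" by simp
  define B where "B = (\<lambda>K. {\<omega> \<in> space M. \<forall>n\<in>{1..K}. F n \<omega> < a * real n})"
  have B_sets [measurable]: "B K \<in> sets M" for K unfolding B_def by measurable
  have "(\<lambda>K. measure M (B K)) \<longlonglongrightarrow> measure M (\<Inter>K. B K)"
    by (rule finite_Lim_measure_decseq) (use B_sets in \<open>auto simp: B_def decseq_def\<close>)
  moreover have "measure M (\<Inter>K. B K) = 0"
  proof -
    have "AE \<omega> in M. \<omega> \<notin> (\<Inter>K. B K)"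
      using large
    proof eventually_elim
      case (elim \<omega>)
      then obtain n where "n \<ge> 1" "a * real n \<le> F n \<omega>" by blast
      then have "\<omega> \<notin> B n" by (force simp: B_def)
      then show ?case by blast
    qed
    then show ?thesis by (simp add: prob_eq_0)
  qed
  ultimately have lim: "(\<lambda>K. measure M (B K)) \<longlonglongrightarrow> 0" by simp
  \<comment> \<open>Makes \<open>a * \<delta>\<close> half of the gap \<open>a - b\<close>; the
    other half outgrows the fixed loss \<open>a * K\<close> for large \<open>N\<close>.\<close>
  define \<delta> where "\<delta> = (a - b) / (2 * a)"
  have "\<delta> > 0" using ba a_pos by (simp add: \<delta>_def)
  then have "\<forall>\<^sub>F K in sequentially. measure M (B K) < \<delta>"
    using order_tendstoD(2)[OF lim] by blast
  then obtain K where K: "measure M (B K) < \<delta>"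
    by (meson eventually_happens trivial_limit_sequentially)
  have main: "a * (real N - real K - real N * \<delta>) \<le> b * real N" for N
  proof -
    have int_ind: "integrable M (\<lambda>\<omega>. indicator (B K) ((shift ^^ i) \<omega>) :: real)" for i
      by (rule integrable_const_bound[where B=1]) (auto simp: indicator_def)
    have ind: "(\<integral>\<omega>. indicator (B K) ((shift ^^ i) \<omega>) \<partial>M) = measure M (B K)" for i
      using integral_funpow_shift[of "indicator (B K)" i] by simp
    have "a * (real N - real K - real N * \<delta>) \<le> a * (real N - real K - real N * measure M (B K))"
      using a K by (intro mult_left_mono diff_left_mono) auto
    also have "\<dots> = (\<integral>\<omega>. a * (real N - real K - (\<Sum>i<N. indicator (B K) ((shift ^^ i) \<omega>))) \<partial>M)"
      using int_ind by (simp add: ind)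
    also have "\<dots> \<le> (\<integral>\<omega>. F N \<omega> \<partial>M)"
    proof (rule integral_mono[OF _ intF])
      show "integrable M (\<lambda>\<omega>. a * (real N - real K - (\<Sum>i<N. indicator (B K) ((shift ^^ i) \<omega>))))"
        using int_ind by auto
      fix \<omega>
      show "a * (real N - real K - (\<Sum>i<N. indicator (B K) ((shift ^^ i) \<omega>))) \<le> F N \<omega>"
        by (rule superadditive_lower_bound[where F = F]) (auto simp: B_def not_less nonneg super a)
    qed
    also have "\<dots> \<le> b * real N" by (rule mean)
    finally show ?thesis .
  qed
  obtain N :: nat where N: "real N > 2 * a * real K / (a - b)"
    using reals_Archimedean2 by blast
  have "a * (real N * \<delta>) = real N * (a - b) / 2"
    using a_pos by (simp add: \<delta>_def)
  moreover have "2 * a * real K < real N * (a - b)"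
    using N ba by (simp add: pos_divide_less_eq)
  ultimately show False using main[of N] by (simp add: algebra_simps)
qed

section \<open>Zero-one laws and the one-sided ergodic theorem\<close>

text \<open>The preimages of \<open>B\<close> under the iterates of \<open>shift\<close> increase
  and all have the measure of \<open>B\<close>; their union is strictly invariant, so ergodicity
  applies to it.\<close>

lemma zero_one_forward_invariant:
  assumes [measurable]: "B \<in> sets M" and inv: "\<And>\<omega>. \<omega> \<in> B \<Longrightarrow> shift \<omega> \<in> B"
  shows "measure M B = 0 \<or> measure M B = 1"
proof -
  define A where "A = (\<lambda>n. (shift ^^ n) -` B)"
  have A_sets: "A n \<in> sets M" for n
    unfolding A_def using measurable_sets[OF funpow_shift_measurable assms(1), of n] by simp
  have "A n \<subseteq> A (Suc n)" for n using inv by (auto simp: A_def)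
  then have "incseq A" by (rule incseq_SucI)
  then have "(\<lambda>n. measure M (A n)) \<longlonglongrightarrow> measure M (\<Union>n. A n)"
    by (intro finite_Lim_measure_incseq) (use A_sets in auto)
  then have eq: "measure M (\<Union>n. A n) = measure M B"
    by (simp add: A_def measure_vimage_funpow_shift LIMSEQ_const_iff)
  have "shift -` (\<Union>n. A n) = (\<Union>n. A n)"
  proof -
    have "shift -` A n = A (Suc n)" for n by (auto simp: A_def funpow_swap1)
    then have "shift -` (\<Union>n. A n) = (\<Union>n. A (Suc n))" by blast
    also have "\<dots> = (\<Union>n. A n)"
      using \<open>incseq A\<close> by (auto simp: incseq_Suc_iff)
    finally show ?thesis .
  qed
  moreover have "(\<Union>n. A n) \<in> sets M" using A_sets by blast
  ultimately show ?thesis using ergodic eq unfolding ergodic_def by auto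
qed

text \<open>The slack q makes the limsup event mapped into itself by the shift.\<close>

lemma zero_one_infinitely_often:
  fixes G :: "nat \<Rightarrow> nat \<Rightarrow> (nat \<Rightarrow> bool) \<Rightarrow> bool"
  assumes [measurable]: "\<And>n q. Measurable.pred M (G n q)"
    and step: "\<And>n q \<omega>. G (Suc n) q \<omega> \<Longrightarrow> G n (q + d) (shift \<omega>)"
  shows "(AE \<omega> in M. \<forall>q. \<forall>\<^sub>F n in sequentially. \<not> G n q \<omega>) \<or>
    (AE \<omega> in M. \<exists>q. \<exists>\<^sub>F n in sequentially. G n q \<omega>)"
proof -
  define B where "B = {\<omega> \<in> space M. \<exists>q. \<forall>m. \<exists>n\<ge>m. G n q \<omega>}"
  have [measurable]: "B \<in> sets M" unfolding B_def by measurable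
  have "shift \<omega> \<in> B" if \<omega>: "\<omega> \<in> B" for \<omega>
  proof -
    obtain q where q: "\<forall>m. \<exists>n\<ge>m. G n q \<omega>" using \<omega> unfolding B_def by auto
    have "\<exists>n\<ge>m. G n (q + d) (shift \<omega>)" for m
    proof -
      obtain n where n: "n \<ge> Suc m" "G n q \<omega>" using q by blast
      then obtain n' where "n = Suc n'" by (cases n) auto
      with n step show ?thesis by auto
    qed
    then show ?thesis unfolding B_def by auto
  qed
  then have "measure M B = 0 \<or> measure M B = 1"
    by (rule zero_one_forward_invariant[rotated]) auto
  then show ?thesis
  proof
    assume "measure M B = 0"
    then have "AE \<omega> in M. \<omega> \<notin> B" by (simp add: prob_eq_0)
    then show ?thesis
      by (auto simp: B_def eventually_sequentially elim!: eventually_mono)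
  next
    assume "measure M B = 1"
    then have "AE \<omega> in M. \<omega> \<in> B" by (simp add: prob_eq_1)
    then show ?thesis
      by (auto simp: B_def frequently_sequentially elim!: eventually_mono)
  qed
qed

text \<open>By the zero-one law it suffices to exclude that the sums almost surely reach
  \<open>c * n\<close>, up to a constant, infinitely often. They would then reach
  \<open>a * n\<close> for an \<open>a\<close> strictly between the mean and \<open>c\<close>,
  against \<open>superadditive_mean_lower_bound\<close>.\<close>

lemma birkhoff_upper:
  assumes [measurable]: "g \<in> borel_measurable M"
    and g0: "\<And>\<omega>. 0 \<le> g \<omega>" and gC: "\<And>\<omega>. g \<omega> \<le> C"
    and c: "(\<integral>\<omega>. g \<omega> \<partial>M) < c"
  shows "AE \<omega> in M. \<forall>\<^sub>F n in sequentially. (\<Sum>i<n. g ((shift ^^ i) \<omega>)) < c * real n"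
proof -
  define S where "S = (\<lambda>n \<omega>. \<Sum>i<n. g ((shift ^^ i) \<omega>))"
  have [measurable]: "S n \<in> borel_measurable M" for n unfolding S_def by measurable
  have S_Suc: "S (Suc n) \<omega> = g \<omega> + S n (shift \<omega>)" for n \<omega>
    unfolding S_def by (simp add: sum.lessThan_Suc_shift funpow_swap1 del: sum.lessThan_Suc)
  \<comment> \<open>The slack \<open>q\<close> pays for the first summand, at most \<open>C\<close>,
    that is dropped on passing to \<open>shift \<omega>\<close>.\<close>
  define G where "G = (\<lambda>n (q::nat) \<omega>. c * real n - real q \<le> S n \<omega>)"
  have [measurable]: "Measurable.pred M (G n q)" for n q unfolding G_def by measurable
  have c0: "0 < c" using c Bochner_Integration.integral_nonneg[of M g] g0 by fastforce
  have "G n (q + nat \<lceil>C\<rceil>) (shift \<omega>)" if "G (Suc n) q \<omega>" for n q \<omega>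
  proof -
    have "g \<omega> \<le> real (nat \<lceil>C\<rceil>)" using gC[of \<omega>] by linarith
    then show ?thesis using that c0 by (simp add: G_def S_Suc algebra_simps)
  qed
  then consider "AE \<omega> in M. \<forall>q. \<forall>\<^sub>F n in sequentially. \<not> G n q \<omega>" |
     "AE \<omega> in M. \<exists>q. \<exists>\<^sub>F n in sequentially. G n q \<omega>"
    using zero_one_infinitely_often[of G "nat \<lceil>C\<rceil>"] by auto
  then show ?thesis
  proof cases
    case 1
    then show ?thesis
    proof eventually_elim
      case (elim \<omega>)
      then have "\<forall>\<^sub>F n in sequentially. \<not> G n 0 \<omega>" by blast
      then show ?case by (simp add: G_def S_def not_le)
    qed
  next
    case 2
    define b where "b = (\<integral>\<omega>. g \<omega> \<partial>M)"
    define a where "a = (b + c) / 2"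
    have b0: "0 \<le> b" unfolding b_def using g0 by (simp add: Bochner_Integration.integral_nonneg)
    have ac: "a < c" "b < a" using c by (auto simp: a_def b_def)
    have int: "integrable M (\<lambda>\<omega>. g ((shift ^^ i) \<omega>))" for i
      by (rule integrable_const_bound[where B=C]) (auto simp: g0 gC)
    have "a \<le> b"
    proof (rule superadditive_mean_lower_bound[of S C])
      show "AE \<omega> in M. \<exists>n\<ge>1. a * real n \<le> S n \<omega>"
        using 2
      proof eventually_elim
        case (elim \<omega>)
        then obtain q where q: "\<exists>\<^sub>F n in sequentially. G n q \<omega>" by blast
        \<comment> \<open>For \<open>n > m\<close> the slack \<open>q\<close> is at most
          \<open>(c - a) * n\<close>, so \<open>c * n - q\<close> is still at least
          \<open>a * n\<close>.\<close>
        obtain m :: nat where m: "real m > real q / (c - a)"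
          using reals_Archimedean2 by blast
        obtain n where n: "n \<ge> Suc m" "G n q \<omega>"
          using q unfolding frequently_sequentially by blast
        have "real q / (c - a) \<le> real n" using m n by linarith
        then have "real q \<le> real n * (c - a)" using ac by (simp add: pos_divide_le_eq)
        then show ?case using n by (intro exI[of _ n]) (auto simp: G_def algebra_simps)
      qed
      show "(\<integral>\<omega>. S N \<omega> \<partial>M) \<le> b * real N" for N
        unfolding S_def using int by (simp add: integral_funpow_shift b_def)
      show "S m \<omega> + S n ((shift ^^ m) \<omega>) \<le> S (m + n) \<omega>" for m n \<omega>
        unfolding S_def by (induction n) (simp_all add: funpow_add add.commute)
      show "S n \<omega> \<le> C * real n" for n \<omega>
        unfolding S_def using sum_mono[of "{..<n}" _ "\<lambda>_. C"] gC by (simp add: mult.commute)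
    qed (use ac b0 g0 in \<open>auto simp: S_def intro: sum_nonneg\<close>)
    with ac show ?thesis by simp
  qed
qed

end

section \<open>Sums over words and the Gibbs inequality\<close>

definition words :: "nat \<Rightarrow> bool list set" where
  "words n = {x. length x = n}"

lemma finite_words [simp]: "finite (words n)"
  using finite_lists_length_eq[of "UNIV :: bool set" n] by (simp add: words_def)

lemma in_words_length [simp]: "x \<in> words (length x)"
  by (simp add: words_def)

lemma words_0 [simp]: "words 0 = {[]}"
  by (auto simp: words_def)

lemma sum_words_append:
  "(\<Sum>x\<in>words (m + n). f x) = (\<Sum>u\<in>words m. \<Sum>v\<in>words n. f (u @ v))"
proof -
  have "bij_betw (\<lambda>(u, v). u @ v) (words m \<times> words n) (words (m + n))"
    by (rule bij_betwI[where g = "\<lambda>x. (take m x, drop m x)"]) (auto simp: words_def)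
  from sum.reindex_bij_betw[OF this, of f] show ?thesis
    by (simp add: sum.cartesian_product case_prod_unfold)
qed

lemma sum_words_Suc:
  "(\<Sum>x\<in>words (Suc n). f x) = (\<Sum>u\<in>words n. f (u @ [True]) + f (u @ [False]))"
proof -
  have "words (Suc 0) = {[True], [False]}"
    by (auto simp: words_def length_Suc_conv)
  then show ?thesis using sum_words_append[of f n "Suc 0"] by simp
qed

text \<open>This is \<open>ln z \<le> z - 1\<close> at \<open>z = Q x / P x\<close>, summed with
  weights \<open>P x\<close>. \<open>Q\<close> may be a subprobability, as
  \<open>parse_weight\<close> will be.\<close>

lemma gibbs_inequality:
  assumes "finite A" and P: "\<And>x. x \<in> A \<Longrightarrow> 0 \<le> P x" and sumP: "sum P A = 1"
    and Q: "\<And>x. x \<in> A \<Longrightarrow> 0 < Q x" and sumQ: "sum Q A \<le> 1"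
  shows "(\<Sum>x\<in>A. P x * log 2 (Q x)) \<le> (\<Sum>x\<in>A. P x * log 2 (P x))"
proof -
  have "P x * log 2 (Q x) - P x * log 2 (P x) \<le> (Q x - P x) / ln 2" if x: "x \<in> A" for x
  proof (cases "P x = 0")
    case True
    then show ?thesis using Q[OF x] by simp
  next
    case False
    then have Px: "0 < P x" using P[OF x] by simp
    have "P x * (ln (Q x) - ln (P x)) = P x * ln (Q x / P x)"
      using Px Q[OF x] by (simp add: ln_div)
    also have "\<dots> \<le> P x * (Q x / P x - 1)"
      using Px Q[OF x] by (intro mult_left_mono ln_le_minus_one) auto
    also have "\<dots> = Q x - P x" using Px by (simp add: field_simps)
    finally have "P x * (ln (Q x) - ln (P x)) / ln 2 \<le> (Q x - P x) / ln 2"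
      by (simp add: divide_right_mono)
    then show ?thesis by (simp add: log_def algebra_simps diff_divide_distrib)
  qed
  then have "(\<Sum>x\<in>A. P x * log 2 (Q x) - P x * log 2 (P x)) \<le> (\<Sum>x\<in>A. (Q x - P x) / ln 2)"
    by (rule sum_mono)
  also have "\<dots> = (sum Q A - 1) / ln 2"
    by (simp add: sumP flip: sum_divide_distrib add: sum_subtractf)
  also have "\<dots> \<le> 0" using sumQ by (simp add: divide_nonpos_pos)
  finally show ?thesis by (simp add: sum_subtractf)
qed

subsection \<open>Sequential predictors\<close>

definition bit_prob :: "real \<Rightarrow> bool \<Rightarrow> real" where
  "bit_prob p b = (if b then p else 1 - p)"

text \<open>\<open>\<pi> u\<close> is read as the conditional probability of \<open>True\<close>
  after the past \<open>u\<close>; the product is the chain rule.\<close>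

definition predictor_prob :: "(bool list \<Rightarrow> real) \<Rightarrow> bool list \<Rightarrow> real" where
  "predictor_prob \<pi> x = (\<Prod>i<length x. bit_prob (\<pi> (take i x)) (x ! i))"

lemma predictor_prob_snoc:
  "predictor_prob \<pi> (x @ [b]) = predictor_prob \<pi> x * bit_prob (\<pi> x) b"
  by (simp add: predictor_prob_def nth_append)

lemma sum_predictor_prob: "(\<Sum>x\<in>words n. predictor_prob \<pi> x) = 1"
proof (induction n)
  case 0
  then show ?case by (simp add: predictor_prob_def)
next
  case (Suc n)
  then show ?case
    by (simp add: sum_words_Suc predictor_prob_snoc bit_prob_def flip: distrib_left)
qed

lemma predictor_prob_pos:
  assumes "\<And>u. 0 < \<pi> u" "\<And>u. \<pi> u < 1"
  shows "0 < predictor_prob \<pi> x"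
  unfolding predictor_prob_def by (intro prod_pos) (simp add: bit_prob_def assms)

subsection \<open>Parsing into weighted blocks\<close>

text \<open>The sum, over all ways to cut \<open>x\<close> into nonempty blocks, of the product of
  the block weights; the recursion runs over the length of the first block.\<close>

function parse_weight :: "(bool list \<Rightarrow> real) \<Rightarrow> bool list \<Rightarrow> real" where
  "parse_weight r x = (if x = [] then 1
     else \<Sum>i\<in>{1..length x}. r (take i x) * parse_weight r (drop i x))"
  by auto
termination by (relation "Wellfounded.measure (\<lambda>(r, x). length x)") auto

declare parse_weight.simps [simp del]

lemma parse_weight_Nil [simp]: "parse_weight r [] = 1"
  by (simp add: parse_weight.simps)

context
  fixes r :: "bool list \<Rightarrow> real"
  assumes r0: "\<And>w. 0 \<le> r w"
begin

lemma parse_weight_nonneg: "0 \<le> parse_weight r x"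
proof (induction x rule: length_induct)
  case (1 x)
  then show ?case
    using r0 by (auto simp: parse_weight.simps[of r x] intro!: sum_nonneg mult_nonneg_nonneg)
qed

text \<open>A parsing of \<open>x\<close> followed by one of \<open>y\<close> is a parsing of
  \<open>x @ y\<close>; parsings with a block across the boundary only add weight. The logarithm
  thus becomes superadditive.\<close>

lemma parse_weight_append: "parse_weight r x * parse_weight r y \<le> parse_weight r (x @ y)"
proof (induction x rule: length_induct)
  case (1 x)
  show ?case
  proof (cases "x = []")
    case False
    have "parse_weight r x * parse_weight r y
        = (\<Sum>i\<in>{1..length x}. r (take i x) * (parse_weight r (drop i x) * parse_weight r y))"
      using False by (simp add: parse_weight.simps[of r x] sum_distrib_right mult.assoc)
    also have "\<dots> \<le> (\<Sum>i\<in>{1..length x}. r (take i x) * parse_weight r (drop i x @ y))"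
      using 1 r0 False by (intro sum_mono mult_left_mono) auto
    also have "\<dots> = (\<Sum>i\<in>{1..length x}. r (take i (x @ y)) * parse_weight r (drop i (x @ y)))"
      by (intro sum.cong) auto
    also have "\<dots> \<le> (\<Sum>i\<in>{1..length (x @ y)}. r (take i (x @ y)) * parse_weight r (drop i (x @ y)))"
      using r0 parse_weight_nonneg by (intro sum_mono2) auto
    also have "\<dots> = parse_weight r (x @ y)"
      using False by (simp add: parse_weight.simps[of r "x @ y"])
    finally show ?thesis .
  qed simp
qed

text \<open>Keep only the parsing into a single block.\<close>

lemma parse_weight_ge: "x \<noteq> [] \<Longrightarrow> r x \<le> parse_weight r x"
  using member_le_sum[of "length x" "{1..length x}" "\<lambda>i. r (take i x) * parse_weight r (drop i x)"]
    r0 parse_weight_nonneg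
  by (auto simp: parse_weight.simps[of r x] Suc_le_eq)

text \<open>Induction after splitting off the first block: the weights of the remainder sum to at
  most 1, which leaves the total weight of the possible first blocks.\<close>

lemma sum_parse_weight_le:
  assumes "\<And>n. (\<Sum>i\<in>{1..n}. \<Sum>w\<in>words i. r w) \<le> 1"
  shows "(\<Sum>x\<in>words n. parse_weight r x) \<le> 1"
proof (induction n rule: less_induct)
  case (less n)
  show ?case
  proof (cases "n = 0")
    case False
    have "(\<Sum>x\<in>words n. parse_weight r x)
        = (\<Sum>x\<in>words n. \<Sum>i\<in>{1..n}. r (take i x) * parse_weight r (drop i x))"
      using False by (intro sum.cong) (auto simp: words_def parse_weight.simps)
    also have "\<dots> = (\<Sum>i\<in>{1..n}. \<Sum>x\<in>words n. r (take i x) * parse_weight r (drop i x))"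
      by (rule sum.swap)
    also have "\<dots> = (\<Sum>i\<in>{1..n}. (\<Sum>u\<in>words i. r u) * (\<Sum>v\<in>words (n - i). parse_weight r v))"
    proof (intro sum.cong refl)
      fix i assume "i \<in> {1..n}"
      then have "words n = words (i + (n - i))" by simp
      then have "(\<Sum>x\<in>words n. r (take i x) * parse_weight r (drop i x))
        = (\<Sum>u\<in>words i. \<Sum>v\<in>words (n - i).
            r (take i (u @ v)) * parse_weight r (drop i (u @ v)))"
        by (simp only: sum_words_append)
      also have "\<dots> = (\<Sum>u\<in>words i. \<Sum>v\<in>words (n - i). r u * parse_weight r v)"
        by (intro sum.cong) (auto simp: words_def)
      finally show "(\<Sum>x\<in>words n. r (take i x) * parse_weight r (drop i x))
        = (\<Sum>u\<in>words i. r u) * (\<Sum>v\<in>words (n - i). parse_weight r v)"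
        by (simp add: sum_product)
    qed
    also have "\<dots> \<le> (\<Sum>i\<in>{1..n}. (\<Sum>u\<in>words i. r u) * 1)"
      using less by (intro sum_mono mult_left_mono sum_nonneg) (auto intro: r0)
    also have "\<dots> \<le> 1" using assms by simp
    finally show ?thesis .
  qed simp
qed

end

subsection \<open>Prefixes\<close>

lemma funpow_shift: "(shift ^^ m) \<omega> = (\<lambda>k. \<omega> (k + m))"
  by (induction m arbitrary: \<omega>) (simp_all add: shift_def)

lemma length_prefix [simp]: "length (prefix n \<omega>) = n"
  by (simp add: prefix_def)

lemma prefix_in_words [simp]: "prefix n \<omega> \<in> words n"
  by (simp add: words_def)

lemma nth_prefix [simp]: "i < n \<Longrightarrow> prefix n \<omega> ! i = \<omega> i"
  by (simp add: prefix_def)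

lemma take_prefix: "i \<le> n \<Longrightarrow> take i (prefix n \<omega>) = prefix i \<omega>"
  by (simp add: prefix_def take_map)

lemma prefix_add: "prefix (m + n) \<omega> = prefix m \<omega> @ prefix n ((shift ^^ m) \<omega>)"
  by (rule nth_equalityI) (auto simp: nth_append funpow_shift)

section \<open>Cylinder probabilities and block entropies\<close>

context ergodic_source
begin

lemma coordinate_measurable [measurable]: "(\<lambda>\<omega>. \<omega> i) \<in> measurable M (count_space UNIV)"
proof -
  have "(\<lambda>\<omega>. \<omega> i) \<in> measurable seq_space (count_space UNIV)"
    unfolding seq_space_def by measurable
  then show ?thesis using sets_M measurable_cong_sets by blast
qed

lemma pred_prefix_eq [measurable]: "Measurable.pred M (\<lambda>\<omega>. prefix n \<omega> = x)"
proof -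
  have "prefix n \<omega> = x \<longleftrightarrow> length x = n \<and> (\<forall>i\<in>{..<n}. \<omega> i = x ! i)" for \<omega>
    by (auto simp: list_eq_iff_nth_eq)
  then show ?thesis by simp
qed

lemma prefix_measurable [measurable]: "prefix n \<in> measurable M (count_space UNIV)"
proof (subst measurable_count_space_eq_countable)
  have "prefix n -` {x} \<inter> space M \<in> sets M" for x
    using pred_prefix_eq[of n x] by (simp add: pred_def vimage_def)
  then show "prefix n \<in> space M \<rightarrow> UNIV \<and> (\<forall>x\<in>UNIV. prefix n -` {x} \<inter> space M \<in> sets M)"
    by auto
qed auto

lemma word_prob_eq: "x \<in> words n \<Longrightarrow> word_prob M x = measure M {\<omega>. prefix n \<omega> = x}"
  by (simp add: word_prob_def words_def)

lemma word_prob_nonneg [simp]: "0 \<le> word_prob M x"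
  by (simp add: word_prob_def)

lemma integral_prefix:
  fixes f :: "bool list \<Rightarrow> real"
  shows "(\<integral>\<omega>. f (prefix n \<omega>) \<partial>M) = (\<Sum>x\<in>words n. word_prob M x * f x)"
proof -
  have sets [measurable]: "{\<omega>. prefix n \<omega> = x} \<in> sets M" for x
    using pred_prefix_eq[of n x] by (simp add: pred_def)
  have "f (prefix n \<omega>) = (\<Sum>x\<in>words n. indicator {\<omega>. prefix n \<omega> = x} \<omega> * f x)" for \<omega>
  proof -
    have "(\<Sum>x\<in>words n. indicator {\<omega>. prefix n \<omega> = x} \<omega> * f x)
      = (\<Sum>x\<in>words n. if x = prefix n \<omega> then f x else 0)"
      by (intro sum.cong) (auto simp: indicator_def)
    then show ?thesis by (simp add: sum.delta)
  qed
  then have "(\<integral>\<omega>. f (prefix n \<omega>) \<partial>M)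
      = (\<integral>\<omega>. (\<Sum>x\<in>words n. indicator {\<omega>. prefix n \<omega> = x} \<omega> * f x) \<partial>M)" by simp
  also have "\<dots> = (\<Sum>x\<in>words n. \<integral>\<omega>. indicator {\<omega>. prefix n \<omega> = x} \<omega> * f x \<partial>M)"
    by (intro Bochner_Integration.integral_sum integrable_mult_left integrable_real_indicator)
      (auto simp: less_top[symmetric])
  also have "\<dots> = (\<Sum>x\<in>words n. word_prob M x * f x)"
    by (intro sum.cong) (auto simp: word_prob_eq)
  finally show ?thesis .
qed

lemma sum_word_prob: "(\<Sum>x\<in>words n. word_prob M x) = 1"
  using integral_prefix[of "\<lambda>_. 1" n] by simp

lemma word_prob_snoc: "word_prob M (u @ [True]) + word_prob M (u @ [False]) = word_prob M u"
proof -
  have sets [measurable]: "{\<omega>. prefix n \<omega> = x} \<in> sets M" for x n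
    using pred_prefix_eq[of n x] by (simp add: pred_def)
  define n where "n = length u"
  have "{\<omega>. prefix n \<omega> = u} = {\<omega>. prefix (Suc n) \<omega> = u @ [True]} \<union> {\<omega>. prefix (Suc n) \<omega> = u @ [False]}"
    by (auto simp: prefix_def n_def)
  then have "measure M {\<omega>. prefix n \<omega> = u} = measure M {\<omega>. prefix (Suc n) \<omega> = u @ [True]} +
      measure M {\<omega>. prefix (Suc n) \<omega> = u @ [False]}"
    by (simp only:) (rule finite_measure_Union; auto)
  then show ?thesis by (simp add: word_prob_def n_def)
qed

text \<open>The cylinder of the longer word lies in the shift preimage of the other cylinder, and
  stationarity preserves the measure. This provides the step condition of
  \<open>zero_one_infinitely_often\<close>.\<close>

lemma word_prob_prefix_shift:
  "word_prob M (prefix (Suc n) \<omega>) \<le> word_prob M (prefix n (shift \<omega>))"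
proof -
  have sets [measurable]: "{\<omega>. prefix n \<omega> = x} \<in> sets M" for x n
    using pred_prefix_eq[of n x] by (simp add: pred_def)
  have "{\<omega>'. prefix (Suc n) \<omega>' = prefix (Suc n) \<omega>}
      \<subseteq> (shift ^^ 1) -` {\<omega>'. prefix n \<omega>' = prefix n (shift \<omega>)}"
    using prefix_add[of 1 n] by auto
  then have "measure M {\<omega>'. prefix (Suc n) \<omega>' = prefix (Suc n) \<omega>}
      \<le> measure M ((shift ^^ 1) -` {\<omega>'. prefix n \<omega>' = prefix n (shift \<omega>)})"
    using measurable_sets[OF funpow_shift_measurable[of 1], of "{\<omega>'. prefix n \<omega>' = prefix n (shift \<omega>)}"]
    by (intro finite_measure_mono) auto
  then show ?thesis
    by (subst (asm) measure_vimage_funpow_shift) (simp_all add: word_prob_def)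
qed

definition block_entropy :: "nat \<Rightarrow> real" where
  "block_entropy n = (\<Sum>x\<in>words n. word_prob M x * - log 2 (word_prob M x))"

text \<open>\<open>gibbs_inequality\<close> with competitor \<open>Q\<close>, whose ideal code
  length is \<open>- log 2 (Q x)\<close>.\<close>

lemma block_entropy_le:
  assumes "\<And>x. x \<in> words n \<Longrightarrow> 0 < Q x" and "(\<Sum>x\<in>words n. Q x) \<le> 1"
  shows "block_entropy n \<le> (\<integral>\<omega>. - log 2 (Q (prefix n \<omega>)) \<partial>M)"
  using gibbs_inequality[of "words n" "word_prob M" Q] assms
    integral_prefix[of "\<lambda>x. - log 2 (Q x)" n]
  by (simp add: block_entropy_def sum_word_prob sum_negf)

lemma block_entropy_1_le: "block_entropy 1 \<le> 1"
proof -
  have "(\<Sum>x\<in>words 1. 1 / 2 :: real) \<le> 1"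
    using sum_words_Suc[of "\<lambda>_. 1 / 2 :: real" 0] by simp
  then have "block_entropy 1 \<le> (\<integral>\<omega>. - log 2 (1 / 2) \<partial>M)"
    using block_entropy_le[of 1 "\<lambda>_. 1 / 2"] by simp
  then show ?thesis by (simp add: log_divide)
qed

text \<open>If words of probability at least \<open>2 powr (-(c * n))\<close> occurred infinitely often, then most
  of a long sample path could be parsed into such words; since there are few of them, this would
  give a code of rate below the entropy.\<close>

lemma word_prob_eventually_less:
  assumes entropy: "\<And>n. \<alpha> * real n \<le> block_entropy n" and c: "c < \<alpha>"
  shows "AE \<omega> in M. \<forall>\<^sub>F n in sequentially. word_prob M (prefix n \<omega>) < 2 powr - (c * real n)"
proof -
  define G where "G = (\<lambda>n (q::nat) \<omega>. 2 powr - (c * real n + real q) \<le> word_prob M (prefix n \<omega>))"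
  have [measurable]: "Measurable.pred M (G n q)" for n q unfolding G_def by measurable
  have "G n (q + nat \<lceil>c\<rceil>) (shift \<omega>)" if "G (Suc n) q \<omega>" for n q \<omega>
  proof -
    have "2 powr - (c * real n + real (q + nat \<lceil>c\<rceil>)) \<le> 2 powr - (c * real (Suc n) + real q)"
      by (intro powr_mono) (auto simp: algebra_simps, linarith)
    then show ?thesis
      using that word_prob_prefix_shift[of n \<omega>] unfolding G_def by linarith
  qed
  then consider "AE \<omega> in M. \<forall>q. \<forall>\<^sub>F n in sequentially. \<not> G n q \<omega>" |
     "AE \<omega> in M. \<exists>q. \<exists>\<^sub>F n in sequentially. G n q \<omega>"
    using zero_one_infinitely_often[of G "nat \<lceil>c\<rceil>"] by auto
  then show ?thesis
  proof cases
    case 1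
    then show ?thesis
    proof eventually_elim
      case (elim \<omega>)
      then have "\<forall>\<^sub>F n in sequentially. \<not> G n 0 \<omega>" by blast
      then show ?case by (simp add: G_def not_le)
    qed
  next
    case 2
    \<comment> \<open>Two levels between \<open>c\<close> and \<open>\<alpha>\<close>: the gap up to
      \<open>c1\<close> absorbs the slack \<open>q\<close>, the gap from \<open>c1\<close> to
      \<open>c2\<close> makes the weights of the likely words summable.\<close>
    define c1 where "c1 = (2 * c + \<alpha>) / 3"
    define c2 where "c2 = (c + 2 * \<alpha>) / 3"
    have c12: "c < c1" "c1 < c2" "c2 < \<alpha>" using c by (auto simp: c1_def c2_def field_simps)
    define t where "t = 2 powr - (c2 - c1)"
    have t: "0 < t" "t < 1" using c12 by (auto simp: t_def powr_less_one)
    then have "summable (\<lambda>i. t ^ i)" by (simp add: summable_geometric)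
    then obtain m where m: "\<And>n. norm (\<Sum>i=m..<n. t ^ i) < 1 / 2"
      unfolding summable_Cauchy by (meson half_gt_zero order_refl zero_less_one)
    define good where "good = (\<lambda>w. m \<le> length w \<and> 2 powr - (c1 * real (length w)) \<le> word_prob M w)"
    \<comment> \<open>Single bits get mass 1/2 in total, so that every word can be parsed; the good
      words get at most 1/2, by the choice of \<open>m\<close>.\<close>
    define r where "r = (\<lambda>w. (if length w = 1 then 1 / 4 else 0) +
      (if good w then 2 powr - (c2 * real (length w)) else 0))"
    have r0: "0 \<le> r w" for w by (simp add: r_def)
    have "(\<Sum>i\<in>{1..n}. \<Sum>w\<in>words i. r w) \<le> 1" for n
    proof -
      have "(\<Sum>w\<in>words i. r w) \<le> (if i = 1 then 1 / 2 else 0) + (if m \<le> i then t ^ i else 0)" for i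
      proof -
        \<comment> \<open>The weight of a good word is \<open>2 powr - (c1 * i) * t ^ i\<close>,
          hence at most its probability times \<open>t ^ i\<close>, and the probabilities sum to
          1.\<close>
        have "(\<Sum>w\<in>words i. if good w then 2 powr - (c2 * real (length w)) else 0)
          \<le> (\<Sum>w\<in>words i. word_prob M w * (if m \<le> i then t ^ i else 0))"
        proof (rule sum_mono)
          fix w assume "w \<in> words i"
          then have len: "length w = i" by (simp add: words_def)
          have "2 powr - (c2 * real i) = 2 powr - (c1 * real i) * t ^ i"
            by (simp add: t_def powr_power flip: powr_add add: algebra_simps)
          then show "(if good w then 2 powr - (c2 * real (length w)) else 0)
            \<le> word_prob M w * (if m \<le> i then t ^ i else 0)"
            using t by (auto simp: good_def len intro: mult_right_mono)
        qed
        also have "\<dots> = (if m \<le> i then t ^ i else 0)"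
          by (simp add: sum_word_prob flip: sum_distrib_right)
        finally have "(\<Sum>w\<in>words i. if good w then 2 powr - (c2 * real (length w)) else 0)
          \<le> (if m \<le> i then t ^ i else 0)" .
        moreover have "(\<Sum>w\<in>words i. if length w = 1 then 1 / 4 else 0 :: real)
            = (if i = 1 then 1 / 2 else 0)"
        proof (cases "i = 1")
          case True
          then show ?thesis
            using sum_words_Suc[of "\<lambda>w. if length w = 1 then 1 / 4 else 0 :: real" 0] by simp
        next
          case False
          then show ?thesis by (auto simp: words_def intro!: sum.neutral)
        qed
        ultimately show ?thesis by (simp add: r_def sum.distrib)
      qed
      then have "(\<Sum>i\<in>{1..n}. \<Sum>w\<in>words i. r w)
        \<le> (\<Sum>i\<in>{1..n}. (if i = 1 then 1 / 2 else 0) + (if m \<le> i then t ^ i else 0))"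
        by (rule sum_mono)
      also have "\<dots> \<le> 1 / 2 + (\<Sum>i\<in>{1..n}. if m \<le> i then t ^ i else 0)"
        by (simp add: sum.distrib)
      also have "(\<Sum>i\<in>{1..n}. if m \<le> i then t ^ i else 0) = (\<Sum>i\<in>{i\<in>{1..n}. m \<le> i}. t ^ i)"
        by (rule sum.inter_filter[symmetric]) simp
      also have "\<dots> \<le> (\<Sum>i=m..<Suc n. t ^ i)"
        using t by (intro sum_mono2) auto
      also have "\<dots> \<le> 1 / 2" using m[of "Suc n"] by simp
      finally show ?thesis by simp
    qed
    note sumQ = sum_parse_weight_le[of r, OF r0 this]
    define Q where "Q = parse_weight r"
    have Q_ge: "x \<noteq> [] \<Longrightarrow> r x \<le> Q x" for x
      unfolding Q_def by (rule parse_weight_ge[OF r0])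
    have Q_append: "Q x * Q y \<le> Q (x @ y)" for x y
      unfolding Q_def by (rule parse_weight_append[OF r0])
    \<comment> \<open>The parsing into single bits.\<close>
    have Q_lower: "(1 / 4) ^ length x \<le> Q x" for x
    proof (induction x)
      case (Cons b x)
      have "1 / 4 \<le> Q [b]"
        using Q_ge[of "[b]"] by (rule order_trans[rotated]) (auto simp: r_def)
      then have "(1 / 4) * (1 / 4) ^ length x \<le> Q [b] * Q x"
        using Cons by (intro mult_mono) auto
      also have "\<dots> \<le> Q (b # x)"
        using Q_append[of "[b]" x] by simp
      finally show ?case by simp
    qed (simp add: Q_def)
    have Q_pos: "0 < Q x" for x
      using Q_lower[of x] by (rule less_le_trans[rotated]) simp
    have Q_le: "Q x \<le> 1" for x
    proof -
      have "Q x \<le> sum Q (words (length x))"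
        using Q_pos by (intro member_le_sum) (auto simp: less_imp_le)
      also have "\<dots> \<le> 1" unfolding Q_def by (rule sumQ)
      finally show ?thesis .
    qed
    \<comment> \<open>By \<open>Q_lower\<close>, adding 2 per bit makes the process nonnegative; by
      \<open>Q_append\<close> it is superadditive.\<close>
    define F where "F = (\<lambda>n \<omega>. 2 * real n + log 2 (Q (prefix n \<omega>)))"
    \<comment> \<open>Good prefixes, parsed as one block, reach the rate \<open>2 - c2\<close>,
      while the entropy caps the mean rate at \<open>2 - \<alpha>\<close>; this contradicts
      \<open>c2 < \<alpha>\<close>.\<close>
    have "2 - c2 \<le> 2 - \<alpha>"
    proof (rule superadditive_mean_lower_bound[of F 2])
      show "F n \<in> borel_measurable M" for n unfolding F_def by measurable
      show "0 \<le> F n \<omega>" for n \<omega>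
      proof -
        have "log 2 ((1 / 4) ^ n) \<le> log 2 (Q (prefix n \<omega>))"
          using Q_lower[of "prefix n \<omega>"] Q_pos by (subst log_le_cancel_iff) auto
        moreover have "log 2 ((1 / 4) ^ n) = - 2 * real n"
        proof -
          have "log 2 (1 / 4 :: real) = log 2 (2 powr (-2))" by (simp add: powr_minus)
          also have "\<dots> = -2" by (subst log_powr_cancel) auto
          finally show ?thesis by (simp add: log_nat_power)
        qed
        ultimately show ?thesis by (simp add: F_def)
      qed
      show "F n \<omega> \<le> 2 * real n" for n \<omega>
        using Q_pos[of "prefix n \<omega>"] Q_le[of "prefix n \<omega>"] by (simp add: F_def)
      show "F k \<omega> + F n ((shift ^^ k) \<omega>) \<le> F (k + n) \<omega>" for k n \<omega>
      proof -
        have "log 2 (Q (prefix k \<omega>) * Q (prefix n ((shift ^^ k) \<omega>))) \<le> log 2 (Q (prefix (k + n) \<omega>))"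
          using Q_append Q_pos
          by (subst log_le_cancel_iff) (auto simp: prefix_add)
        then show ?thesis using Q_pos by (simp add: F_def log_mult_pos algebra_simps)
      qed
      \<comment> \<open>The entropy of one bit gives \<open>\<alpha> \<le> 1\<close>.\<close>
      show "0 \<le> 2 - c2"
        using c12 entropy[of 1] block_entropy_1_le by simp
      show "AE \<omega> in M. \<exists>n\<ge>1. (2 - c2) * real n \<le> F n \<omega>"
        using 2
      proof eventually_elim
        case (elim \<omega>)
        then obtain q where q: "\<exists>\<^sub>F n in sequentially. G n q \<omega>" by blast
        obtain k :: nat where k: "real k > real q / (c1 - c)"
          using reals_Archimedean2 by blast
        obtain n where n: "n \<ge> Suc (max k m)" "G n q \<omega>"
          using q unfolding frequently_sequentially by blast
        have "real q / (c1 - c) \<le> real n" using k n by linarith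
        then have "real q \<le> real n * (c1 - c)" using c12 by (simp add: pos_divide_le_eq)
        then have "2 powr - (c1 * real n) \<le> 2 powr - (c * real n + real q)"
          by (intro powr_mono) (auto simp: algebra_simps)
        also have "\<dots> \<le> word_prob M (prefix n \<omega>)" using n by (simp add: G_def)
        finally have "good (prefix n \<omega>)" using n by (simp add: good_def)
        then have "2 powr - (c2 * real n) \<le> r (prefix n \<omega>)" by (simp add: r_def)
        also have "\<dots> \<le> Q (prefix n \<omega>)"
          using n by (intro Q_ge) (auto simp: prefix_def)
        finally have "- (c2 * real n) \<le> log 2 (Q (prefix n \<omega>))"
          using Q_pos by (simp add: le_log_iff)
        then show ?case using n by (intro exI[of _ n]) (auto simp: F_def algebra_simps)
      qed
      show "(\<integral>\<omega>. F N \<omega> \<partial>M) \<le> (2 - \<alpha>) * real N" for N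
      proof -
        have "block_entropy N \<le> (\<integral>\<omega>. - log 2 (Q (prefix N \<omega>)) \<partial>M)"
          using Q_pos sumQ by (intro block_entropy_le) (auto simp: Q_def)
        moreover have "(\<integral>\<omega>. F N \<omega> \<partial>M) = 2 * real N - (\<integral>\<omega>. - log 2 (Q (prefix N \<omega>)) \<partial>M)"
          unfolding F_def
          using integral_prefix[of "\<lambda>x. 2 * real N + log 2 (Q x)" N]
            integral_prefix[of "\<lambda>x. - log 2 (Q x)" N]
          by (simp add: distrib_left sum.distrib sum_negf sum_word_prob flip: sum_distrib_right)
        ultimately show ?thesis using entropy[of N] by (simp add: algebra_simps)
      qed
    qed
    then show ?thesis using c12 by simp
  qed
qed

end

subsection \<open>Markov predictors with rational parameters\<close>

text \<open>Finite tables with rational entries are countably many. The default 1/2 turns every list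
  into a predictor that is never certain.\<close>

definition table_prob :: "(bool list \<times> rat) list \<Rightarrow> bool list \<Rightarrow> real" where
  "table_prob l u = (case map_of l u of
     None \<Rightarrow> 1 / 2
   | Some p \<Rightarrow> if 0 < p \<and> p < 1 then of_rat p else 1 / 2)"

text \<open>A table takes only finitely many values, all strictly between 0 and 1. The uniform
  margin keeps the losses bounded.\<close>

lemma table_prob_bounds: "\<exists>c>0. \<forall>u. c \<le> table_prob l u \<and> table_prob l u \<le> 1 - c"
proof -
  define S :: "real set" where "S = insert (1 / 2) (of_rat ` {p \<in> snd ` set l. 0 < p \<and> p < 1})"
  have S: "finite S" "S \<noteq> {}" by (auto simp: S_def)
  have S01: "0 < min p (1 - p)" if "p \<in> S" for p using that by (auto simp: S_def)
  have in_S: "table_prob l u \<in> S" for u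
    by (force simp: S_def table_prob_def split: option.splits dest: map_of_SomeD)
  define c where "c = Min ((\<lambda>p. min p (1 - p)) ` S)"
  have "c \<le> min (table_prob l u) (1 - table_prob l u)" for u
    unfolding c_def using S in_S by (intro Min_le) auto
  then have "c \<le> table_prob l u \<and> c \<le> 1 - table_prob l u" for u
    by (simp only: min.bounded_iff)
  moreover have "0 < c"
    unfolding c_def using S S01 by (subst Min_gr_iff) auto
  ultimately show ?thesis by (intro exI[of _ c]) (auto simp: algebra_simps)
qed

lemma table_prob_pos: "0 < table_prob l u" and table_prob_less_1: "table_prob l u < 1"
  using table_prob_bounds[of l] by (fastforce dest: spec[of _ u])+

text \<open>The context is the last \<open>k\<close> bits; truncated subtraction makes it all of
  \<open>u\<close> when \<open>u\<close> is shorter.\<close>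

definition markov_predictor :: "nat \<Rightarrow> (bool list \<times> rat) list \<Rightarrow> bool list \<Rightarrow> real" where
  "markov_predictor k l u = table_prob l (drop (length u - k) u)"

text \<open>A function of the fixed window of the first \<open>k + 1\<close> bits, so that
  successive losses are its values along the shift orbit.\<close>

definition markov_loss :: "nat \<Rightarrow> (bool list \<times> rat) list \<Rightarrow> (nat \<Rightarrow> bool) \<Rightarrow> real" where
  "markov_loss k l \<omega> = - log 2 (bit_prob (table_prob l (prefix k \<omega>)) (\<omega> k))"

definition markov_prob :: "nat \<Rightarrow> (bool list \<times> rat) list \<Rightarrow> bool list \<Rightarrow> real" where
  "markov_prob k l = predictor_prob (markov_predictor k l)"

lemma markov_prob_pos: "0 < markov_prob k l x"
  unfolding markov_prob_def
  by (intro predictor_prob_pos) (simp_all add: markov_predictor_def table_prob_pos table_prob_less_1)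

lemma sum_markov_prob: "(\<Sum>x\<in>words n. markov_prob k l x) = 1"
  by (simp add: markov_prob_def sum_predictor_prob)

text \<open>The code length is the sum of the prediction losses. From time \<open>k\<close> on these
  are shifts of \<open>markov_loss\<close>; the first \<open>k\<close>, with incomplete context,
  cost at most \<open>C\<close> each.\<close>

lemma markov_loss_bounds:
  obtains C where "\<And>\<omega>. 0 \<le> markov_loss k l \<omega>" "\<And>\<omega>. markov_loss k l \<omega> \<le> C"
    "\<And>n \<omega>. - log 2 (markov_prob k l (prefix n \<omega>))
      \<le> C * real k + (\<Sum>i<n. markov_loss k l ((shift ^^ i) \<omega>))"
proof -
  obtain c where c: "0 < c" "\<And>u. c \<le> table_prob l u" "\<And>u. table_prob l u \<le> 1 - c"
    using table_prob_bounds by blast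
  have bit: "c \<le> bit_prob (table_prob l u) b" "bit_prob (table_prob l u) b \<le> 1" for u b
    using c(2)[of u] c(3)[of u] c(1) by (auto simp: bit_prob_def)
  then have bit_pos: "0 < bit_prob (table_prob l u) b" for u b
    using c(1) less_le_trans by blast
  define C where "C = - log 2 c"
  have loss0: "0 \<le> - log 2 (bit_prob (table_prob l u) b)" for u b
    using bit bit_pos by simp
  have lossC: "- log 2 (bit_prob (table_prob l u) b) \<le> C" for u b
    using bit bit_pos c(1) by (simp add: C_def)
  have "- log 2 (markov_prob k l (prefix n \<omega>))
      \<le> C * real k + (\<Sum>i<n. markov_loss k l ((shift ^^ i) \<omega>))" for n \<omega>
  proof -
    define a where "a = (\<lambda>i. - log 2 (bit_prob (markov_predictor k l (prefix i \<omega>)) (\<omega> i)))"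
    have a0: "0 \<le> a i" and aC: "a i \<le> C" for i
      using loss0 lossC by (simp_all add: a_def markov_predictor_def)
    have "a (k + i) = markov_loss k l ((shift ^^ i) \<omega>)" for i
    proof -
      have "prefix (k + i) \<omega> = prefix i \<omega> @ prefix k ((shift ^^ i) \<omega>)"
        using prefix_add[of i k] by (simp add: add.commute)
      then show ?thesis
        by (simp add: a_def markov_loss_def markov_predictor_def funpow_shift)
    qed
    note shifted = this
    have "- log 2 (markov_prob k l (prefix n \<omega>)) = sum a {..<n}"
    proof -
      have "log 2 (\<Prod>i<n. bit_prob (markov_predictor k l (prefix i \<omega>)) (\<omega> i))
          = (\<Sum>i<n. log 2 (bit_prob (markov_predictor k l (prefix i \<omega>)) (\<omega> i)))"
        by (induction n)
          (simp_all add: log_mult_pos prod_pos bit_pos markov_predictor_def)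
      then show ?thesis
        by (simp add: a_def markov_prob_def predictor_prob_def take_prefix sum_negf)
    qed
    \<comment> \<open>Padding by \<open>k\<close> terms leaves exactly \<open>n\<close> shifted
      losses after the first \<open>k\<close>.\<close>
    also have "\<dots> \<le> sum a {..<k + n}" using a0 by (intro sum_mono2) auto
    also have "\<dots> = sum a {..<k} + (\<Sum>i<n. a (k + i))" by (induction n) auto
    also have "\<dots> \<le> C * real k + (\<Sum>i<n. a (k + i))"
      using sum_mono[of "{..<k}" a "\<lambda>_. C"] aC by (simp add: mult.commute)
    finally show ?thesis by (simp add: shifted)
  qed
  then show ?thesis using that[of C] loss0 lossC by (simp add: markov_loss_def)
qed

section \<open>Expected Markov losses and the entropy rate\<close>

context ergodic_source
begin

definition mean_loss :: "nat \<Rightarrow> (bool list \<times> rat) list \<Rightarrow> real" where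
  "mean_loss k l = (\<integral>\<omega>. markov_loss k l \<omega> \<partial>M)"

lemma markov_loss_measurable [measurable]: "markov_loss k l \<in> borel_measurable M"
  unfolding markov_loss_def by measurable

lemma mean_loss_nonneg: "0 \<le> mean_loss k l"
  unfolding mean_loss_def
  by (rule markov_loss_bounds[of k l]) (simp add: Bochner_Integration.integral_nonneg)

text \<open>The Markov measure is the competitor in the Gibbs inequality, and by stationarity its
  expected code length is linear up to the cost of the first \<open>k\<close> bits.\<close>

lemma block_entropy_le_mean_loss: "\<exists>D. \<forall>n. block_entropy n \<le> D + mean_loss k l * real n"
proof -
  obtain C where C: "\<And>\<omega>. 0 \<le> markov_loss k l \<omega>" "\<And>\<omega>. markov_loss k l \<omega> \<le> C"
    "\<And>n \<omega>. - log 2 (markov_prob k l (prefix n \<omega>))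
      \<le> C * real k + (\<Sum>i<n. markov_loss k l ((shift ^^ i) \<omega>))"
    using markov_loss_bounds by blast
  have int: "integrable M (\<lambda>\<omega>. markov_loss k l ((shift ^^ i) \<omega>))" for i
    by (rule integrable_const_bound[where B=C]) (auto simp: C)
  have "block_entropy n \<le> C * real k + mean_loss k l * real n" for n
  proof -
    have "block_entropy n \<le> (\<integral>\<omega>. - log 2 (markov_prob k l (prefix n \<omega>)) \<partial>M)"
      by (rule block_entropy_le[OF markov_prob_pos]) (simp add: sum_markov_prob)
    also have "\<dots> \<le> (\<integral>\<omega>. C * real k + (\<Sum>i<n. markov_loss k l ((shift ^^ i) \<omega>)) \<partial>M)"
    proof (rule integral_mono')
      show "integrable M (\<lambda>\<omega>. C * real k + (\<Sum>i<n. markov_loss k l ((shift ^^ i) \<omega>)))"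
        using int by auto
    qed (use C in \<open>auto intro!: sum_nonneg add_nonneg_nonneg mult_nonneg_nonneg order_trans[OF C(1) C(2)]\<close>)
    also have "\<dots> = C * real k + mean_loss k l * real n"
      using int by (simp add: integral_funpow_shift mean_loss_def)
    finally show ?thesis .
  qed
  then show ?thesis by blast
qed

text \<open>The one-sided ergodic theorem for the losses at a rate strictly below \<open>c\<close>;
  the remaining gap absorbs the constant \<open>C * k\<close>.\<close>

lemma markov_prob_eventually_ge:
  assumes c: "mean_loss k l < c"
  shows "AE \<omega> in M. \<forall>\<^sub>F n in sequentially. - log 2 (markov_prob k l (prefix n \<omega>)) \<le> c * real n"
proof -
  obtain C where C: "\<And>\<omega>. 0 \<le> markov_loss k l \<omega>" "\<And>\<omega>. markov_loss k l \<omega> \<le> C"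
    "\<And>n \<omega>. - log 2 (markov_prob k l (prefix n \<omega>))
      \<le> C * real k + (\<Sum>i<n. markov_loss k l ((shift ^^ i) \<omega>))"
    using markov_loss_bounds by blast
  define c' where "c' = (mean_loss k l + c) / 2"
  have c': "mean_loss k l < c'" "c' < c" using c by (auto simp: c'_def)
  have "AE \<omega> in M. \<forall>\<^sub>F n in sequentially. (\<Sum>i<n. markov_loss k l ((shift ^^ i) \<omega>)) < c' * real n"
    using c'(1) C by (intro birkhoff_upper[where C=C]) (auto simp: mean_loss_def)
  then show ?thesis
  proof eventually_elim
    case (elim \<omega>)
    moreover have "\<forall>\<^sub>F n in sequentially. C * real k / (c - c') \<le> real n"
      using filterlim_real_sequentially unfolding filterlim_at_top by blast
    ultimately show ?case
    proof eventually_elim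
      case (elim n)
      then have "C * real k \<le> real n * (c - c')" using c' by (simp add: pos_divide_le_eq)
      then show ?case using C(3)[of n \<omega>] elim(1) by (simp add: algebra_simps)
    qed
  qed
qed

text \<open>The true conditional probabilities given \<open>k\<close> bits have mean loss equal to
  the conditional entropy. Rational approximations that keep at least the fraction
  \<open>2 powr - d\<close> of each cost at most \<open>d\<close> more bits.\<close>

lemma mean_loss_le_conditional_entropy:
  assumes d: "0 < d"
  shows "\<exists>l. mean_loss k l \<le> block_entropy (Suc k) - block_entropy k + d"
proof -
  define P where "P = word_prob M"
  define s where "s = 2 powr - d"
  have s: "0 < s" "s < 1" using d by (auto simp: s_def powr_less_one)
  have P0: "0 \<le> P x" for x by (simp add: P_def)
  have P_snoc: "P u = P (u @ [True]) + P (u @ [False])" for u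
    by (simp add: P_def word_prob_snoc)
  define p where "p = (\<lambda>u. P (u @ [True]) / P u)"
  have p: "0 \<le> p u" "p u \<le> 1" for u
    using P0[of "u @ [True]"] P0[of "u @ [False]"] P_snoc[of u]
    by (auto simp: p_def divide_le_eq_1)
  \<comment> \<open>The interval is nonempty since \<open>s < 1\<close>; its two ends ensure that
    both \<open>q\<close> and \<open>1 - q\<close> keep the fraction \<open>s\<close> of
    \<open>p u\<close> and \<open>1 - p u\<close>.\<close>
  have "\<exists>q. p u * s < of_rat q \<and> of_rat q < 1 - (1 - p u) * s" for u
    using s by (intro of_rat_dense) (simp add: algebra_simps)
  then obtain q where q: "\<And>u. p u * s < of_rat (q u)" "\<And>u. of_rat (q u) < 1 - (1 - p u) * s"
    by metis
  have q01: "0 < q u" "q u < 1" for u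
  proof -
    have "(0::real) < of_rat (q u)" using q(1)[of u] p s by (smt (verit) mult_nonneg_nonneg)
    then show "0 < q u" by simp
    have "of_rat (q u) < (1::real)" using q(2)[of u] p s by (smt (verit) mult_nonneg_nonneg)
    then show "q u < 1" by simp
  qed
  have "\<exists>us. set us = words k" using finite_list[OF finite_words] .
  then obtain us where us: "set us = words k" by blast
  define l where "l = map (\<lambda>u. (u, q u)) us"
  have table: "table_prob l u = of_rat (q u)" if "u \<in> words k" for u
    using that us q01 by (simp add: table_prob_def l_def map_of_map_restrict)
  define B where "B = (\<lambda>u b. bit_prob (table_prob l u) b)"
  have term_le: "P (u @ [b]) * - log 2 (B u b) \<le> P (u @ [b]) * (- log 2 (P (u @ [b])) + log 2 (P u) + d)"
    if u: "u \<in> words k" for u b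
  proof (cases "P (u @ [b]) = 0")
    case False
    have pos: "0 < P (u @ [b])" "0 < P u"
      using False P0[of "u @ [True]"] P0[of "u @ [False]"] P_snoc[of u] by (cases b; simp)+
    have "P (u @ [b]) / P u = bit_prob (p u) b"
      using pos(2) P_snoc[of u] by (cases b) (simp_all add: bit_prob_def p_def eq_diff_eq flip: add_divide_distrib)
    then have "P (u @ [b]) / P u * s \<le> B u b"
      using q[of u] by (auto simp: B_def table[OF u] bit_prob_def)
    then have "log 2 (P (u @ [b]) / P u * s) \<le> log 2 (B u b)"
      using pos s by (subst log_le_cancel_iff) (auto intro: less_le_trans[rotated])
    then have "- log 2 (B u b) \<le> - log 2 (P (u @ [b])) + log 2 (P u) + d"
      using pos s by (simp add: log_mult_pos log_divide_pos s_def)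
    then show ?thesis using P0 by (rule mult_left_mono)
  qed simp
  have "mean_loss k l = (\<integral>\<omega>. (\<lambda>x. - log 2 (B (take k x) (x ! k))) (prefix (Suc k) \<omega>) \<partial>M)"
    unfolding mean_loss_def markov_loss_def B_def by (simp add: take_prefix)
  also have "\<dots> = (\<Sum>x\<in>words (Suc k). P x * - log 2 (B (take k x) (x ! k)))"
    unfolding P_def by (rule integral_prefix)
  also have "\<dots> = (\<Sum>u\<in>words k. P (u @ [True]) * - log 2 (B u True) + P (u @ [False]) * - log 2 (B u False))"
    unfolding sum_words_Suc by (intro sum.cong) (auto simp: words_def nth_append)
  also have "\<dots> \<le> (\<Sum>u\<in>words k. P (u @ [True]) * (- log 2 (P (u @ [True])) + log 2 (P u) + d)
      + P (u @ [False]) * (- log 2 (P (u @ [False])) + log 2 (P u) + d))"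
    by (intro sum_mono add_mono term_le)
  \<comment> \<open>The chain rule for entropy: the probabilities of the two extensions recombine to
    \<open>P u\<close>.\<close>
  also have "\<dots> = (\<Sum>u\<in>words k. (P (u @ [True]) * - log 2 (P (u @ [True]))
      + P (u @ [False]) * - log 2 (P (u @ [False]))) + P u * log 2 (P u) + d * P u)"
  proof (intro sum.cong refl)
    fix u
    have "P u * z = P (u @ [True]) * z + P (u @ [False]) * z" for z
      using P_snoc[of u] by (simp flip: distrib_right)
    from this[of "log 2 (P u)"] this[of d]
    show "P (u @ [True]) * (- log 2 (P (u @ [True])) + log 2 (P u) + d)
      + P (u @ [False]) * (- log 2 (P (u @ [False])) + log 2 (P u) + d)
      = (P (u @ [True]) * - log 2 (P (u @ [True]))
      + P (u @ [False]) * - log 2 (P (u @ [False]))) + P u * log 2 (P u) + d * P u"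
      by (simp add: algebra_simps)
  qed
  also have "\<dots> = block_entropy (Suc k) - block_entropy k + d"
    unfolding block_entropy_def sum_words_Suc
    by (simp add: sum.distrib sum_negf sum_word_prob sum_subtractf P_def flip: sum_distrib_left)
  finally show ?thesis by blast
qed

definition min_loss :: real where
  "min_loss = (INF (k, l)\<in>UNIV. mean_loss k l)"

lemma min_loss_le: "min_loss \<le> mean_loss k l"
  unfolding min_loss_def
  by (rule cINF_lower2[of _ _ "(k, l)"]) (auto intro!: bdd_belowI[of _ 0] mean_loss_nonneg)

lemma min_loss_less:
  assumes "min_loss < c" obtains k l where "mean_loss k l < c"
proof -
  have "\<exists>x\<in>UNIV. (case x of (k, l) \<Rightarrow> mean_loss k l) < c"
    using assms unfolding min_loss_def
    by (subst (asm) cINF_less_iff) (auto intro!: bdd_belowI[of _ 0] mean_loss_nonneg)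
  then show ?thesis using that by auto
qed

text \<open>Telescoping: each increment of the block entropy is, up to any \<open>d > 0\<close>, at
  least the mean loss of some table.\<close>

lemma min_loss_le_block_entropy: "min_loss * real n \<le> block_entropy n"
proof (induction n)
  case 0
  then show ?case by (simp add: block_entropy_def word_prob_def prefix_def)
next
  case (Suc n)
  have "min_loss \<le> block_entropy (Suc n) - block_entropy n"
  proof (rule field_le_epsilon)
    fix d :: real assume "0 < d"
    then show "min_loss \<le> block_entropy (Suc n) - block_entropy n + d"
      using mean_loss_le_conditional_entropy min_loss_le order_trans by blast
  qed
  then show ?case using Suc by (simp add: algebra_simps)
qed

text \<open>The entropies per bit lie above \<open>min_loss\<close> and eventually below any larger
  bound, by a table of nearly minimal loss. Hence they converge and \<open>lim\<close> denotes their
  limit.\<close>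

lemma entropy_rate_eq_min_loss: "entropy_rate M = min_loss"
proof -
  have "(\<lambda>n. block_entropy n / real n) \<longlonglongrightarrow> min_loss"
  proof (rule order_tendstoI)
    fix a assume "a < min_loss"
    show "\<forall>\<^sub>F n in sequentially. a < block_entropy n / real n"
      using eventually_gt_at_top[of 0]
    proof eventually_elim
      case (elim n)
      then have "min_loss \<le> block_entropy n / real n"
        using min_loss_le_block_entropy[of n] by (simp add: field_simps)
      with \<open>a < min_loss\<close> show ?case by simp
    qed
  next
    fix a assume "min_loss < a"
    then obtain k l where kl: "mean_loss k l < a" by (rule min_loss_less)
    obtain D where D: "\<And>n. block_entropy n \<le> D + mean_loss k l * real n"
      using block_entropy_le_mean_loss by blast
    have "\<forall>\<^sub>F n in sequentially. D / (a - mean_loss k l) < real n"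
      using filterlim_real_sequentially unfolding filterlim_at_top_dense by blast
    then show "\<forall>\<^sub>F n in sequentially. block_entropy n / real n < a"
      using eventually_gt_at_top[of 0]
    proof eventually_elim
      case (elim n)
      then have "D < real n * (a - mean_loss k l)" using kl by (simp add: pos_divide_less_eq)
      then have "block_entropy n < a * real n" using D[of n] by (simp add: algebra_simps)
      then show ?case using elim by (simp add: pos_divide_less_eq)
    qed
  qed
  moreover have "entropy_rate M = lim (\<lambda>n. block_entropy n / real n)"
    by (simp add: entropy_rate_def block_entropy_def words_def sum_negf)
  ultimately show ?thesis by (simp add: limI)
qed

end

subsection \<open>The universal statistic\<close>

text \<open>Elements are inserted in nondecreasing order of \<open>f\<close>, each new one receiving
  a value above all earlier ones; ties are thus broken by insertion order.\<close>

lemma exists_injective_refinement: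
  fixes f :: "'a \<Rightarrow> real"
  assumes "finite A"
  shows "\<exists>g :: 'a \<Rightarrow> real. inj_on g A \<and> (\<forall>x\<in>A. \<forall>y\<in>A. f x < f y \<longrightarrow> g x < g y)"
  using assms
proof (induction A rule: finite_ranking_induct[where f = f])
  case (insert x S)
  show ?case
  proof (cases "x \<in> S")
    case False
    obtain g :: "'a \<Rightarrow> real" where g: "inj_on g S" "\<forall>x\<in>S. \<forall>y\<in>S. f x < f y \<longrightarrow> g x < g y"
      using insert by blast
    define m where "m = Max (insert 0 (g ` S)) + 1"
    have m: "g y < m" if "y \<in> S" for y
    proof -
      have "g y \<le> Max (insert 0 (g ` S))" using that insert(1) by (intro Max_ge) auto
      then show ?thesis by (simp add: m_def)
    qed
    have "inj_on (g(x := m)) (insert x S)"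
      using g(1) m False by (auto simp: inj_on_def dest: m)
    moreover have "\<forall>y\<in>insert x S. \<forall>z\<in>insert x S. f y < f z \<longrightarrow> (g(x := m)) y < (g(x := m)) z"
      using g(2) m False insert(2) by (auto simp: not_less[symmetric])
    ultimately show ?thesis by blast
  qed (use insert in \<open>simp add: insert_absorb\<close>)
qed auto

text \<open>A smaller value of \<open>g\<close> has strictly more elements above it.\<close>

lemma inj_on_card_greater:
  fixes g :: "'a \<Rightarrow> real"
  assumes "finite A" "inj_on g A"
  shows "inj_on (\<lambda>x. card {y \<in> A. g x < g y}) A"
proof -
  have less: "card {z \<in> A. g y < g z} < card {z \<in> A. g x < g z}" if "x \<in> A" "y \<in> A" "g x < g y" for x y
    using that assms(1) by (intro psubset_card_mono) auto
  show ?thesis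
  proof (rule inj_onI)
    fix x y assume xy: "x \<in> A" "y \<in> A" "card {z \<in> A. g x < g z} = card {z \<in> A. g y < g z}"
    then have "g x = g y" using less[of x y] less[of y x] by linarith
    then show "x = y" using assms(2) xy by (simp add: inj_on_eq_iff)
  qed
qed

definition top_word :: "nat \<Rightarrow> bool list" where
  "top_word n = replicate (n - 1) False @ [True]"

text \<open>An infinite sequence has at most one prefix of the form \<open>top_word n\<close>, so placing this word
  above all others keeps the p-value positive along every sequence from some point on
  (in HOL the logarithm of 0 is 0).\<close>

lemma eventually_prefix_neq_top_word: "\<forall>\<^sub>F n in sequentially. prefix n \<omega> \<noteq> top_word n"
proof (cases "\<exists>m\<ge>1. prefix m \<omega> = top_word m")
  case True
  then obtain m where m: "m \<ge> 1" "prefix m \<omega> = top_word m" by blast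
  then have "\<omega> (m - 1)"
    using nth_prefix[of "m - 1" m \<omega>] by (simp add: top_word_def nth_append)
  \<comment> \<open>The bit at position \<open>m - 1\<close> is \<open>True\<close>, whereas a
    longer top word has \<open>False\<close> there.\<close>
  then have "prefix n \<omega> \<noteq> top_word n" if "n > m" for n
  proof -
    have "prefix n \<omega> ! (m - 1)" "\<not> top_word n ! (m - 1)"
      using \<open>\<omega> (m - 1)\<close> that m(1) by (auto simp: top_word_def nth_append)
    then show ?thesis by metis
  qed
  then show ?thesis by (auto intro: eventually_mono[OF eventually_gt_at_top[of m]])
next
  case False
  then show ?thesis by (auto intro: eventually_mono[OF eventually_ge_at_top[of 1]])
qed

definition coded_markov_prob :: "nat \<Rightarrow> bool list \<Rightarrow> real" where
  "coded_markov_prob j = (case from_nat j of (k, l) \<Rightarrow> markov_prob k l)"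

text \<open>An unnormalized mixture of the first \<open>n\<close> Markov measures: each enters once
  \<open>n\<close> exceeds its index, and the total mass, linear in \<open>n\<close>, vanishes in
  the exponent. The bonus \<open>n + 1\<close> exceeds the weight of any other word, which is at
  most \<open>n\<close>.\<close>

definition universal_weight :: "nat \<Rightarrow> bool list \<Rightarrow> real" where
  "universal_weight n x =
     (\<Sum>j<n. coded_markov_prob j x) + (if x = top_word n then real n + 1 else 0)"

lemma coded_markov_prob_pos: "0 < coded_markov_prob j x"
  by (simp add: coded_markov_prob_def markov_prob_pos split: prod.split)

lemma sum_coded_markov_prob: "(\<Sum>x\<in>words n. coded_markov_prob j x) = 1"
  by (simp add: coded_markov_prob_def sum_markov_prob split: prod.split)

lemma coded_markov_prob_le_1: "coded_markov_prob j x \<le> 1"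
  using member_le_sum[of x "words (length x)" "coded_markov_prob j"]
  by (simp add: sum_coded_markov_prob coded_markov_prob_pos less_imp_le)

lemma universal_weight_nonneg: "0 \<le> universal_weight n x"
  unfolding universal_weight_def
  by (intro add_nonneg_nonneg sum_nonneg) (simp_all add: coded_markov_prob_pos less_imp_le)

lemma coded_markov_prob_le_universal_weight: "j < n \<Longrightarrow> coded_markov_prob j x \<le> universal_weight n x"
  unfolding universal_weight_def
  using member_le_sum[of j "{..<n}" "\<lambda>j. coded_markov_prob j x"]
  by (intro order_trans[OF _ add_increasing2]) (auto simp: coded_markov_prob_pos less_imp_le)

lemma universal_weight_less_top_word:
  assumes "x \<noteq> top_word n" shows "universal_weight n x < universal_weight n (top_word n)"
proof -
  have "universal_weight n x \<le> real n"
    using assms sum_mono[of "{..<n}" "\<lambda>j. coded_markov_prob j x" "\<lambda>_. 1"] coded_markov_prob_le_1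
    by (simp add: universal_weight_def)
  also have "real n < universal_weight n (top_word n)"
    using sum_nonneg[of "{..<n}" "\<lambda>j. coded_markov_prob j (top_word n)"]
    by (simp add: universal_weight_def coded_markov_prob_pos less_imp_le)
  finally show ?thesis .
qed

lemma sum_universal_weight: "(\<Sum>x\<in>words n. universal_weight n x) \<le> 2 * real n + 1"
proof -
  have "(\<Sum>x\<in>words n. \<Sum>j<n. coded_markov_prob j x) = (\<Sum>j<n. \<Sum>x\<in>words n. coded_markov_prob j x)"
    by (rule sum.swap)
  then show ?thesis
    by (simp add: universal_weight_def sum.distrib sum_coded_markov_prob sum.delta)
qed

definition stat_rank :: "(nat \<Rightarrow> bool list \<Rightarrow> real) \<Rightarrow> nat \<Rightarrow> bool list \<Rightarrow> nat" where
  "stat_rank \<tau> n x = card {y \<in> words n. \<tau> n x < \<tau> n y}"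

lemma pval_eq_rank: "x \<in> words n \<Longrightarrow> pval \<tau> x = real (stat_rank \<tau> n x) / 2 ^ n"
  by (auto simp: pval_def stat_rank_def words_def)

definition universal_statistic :: "(nat \<Rightarrow> bool list \<Rightarrow> real) \<Rightarrow> bool" where
  "universal_statistic \<tau> \<longleftrightarrow> (\<forall>n. inj_on (\<tau> n) (words n) \<and>
     (\<forall>x\<in>words n. \<forall>y\<in>words n. universal_weight n x < universal_weight n y \<longrightarrow> \<tau> n x < \<tau> n y))"

lemma exists_universal_statistic: "\<exists>\<tau>. universal_statistic \<tau>"
  unfolding universal_statistic_def
  by (rule choice) (intro allI exists_injective_refinement finite_words)

context
  fixes \<tau> assumes \<tau>: "universal_statistic \<tau>"
begin

lemma inj_on_rank: "inj_on (stat_rank \<tau> n) (words n)"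
  using \<tau> inj_on_card_greater[of "words n" "\<tau> n"]
  unfolding universal_statistic_def stat_rank_def by auto

lemma rank_pos:
  assumes "x \<in> words n" "0 < n" "x \<noteq> top_word n" shows "0 < stat_rank \<tau> n x"
proof -
  have "top_word n \<in> words n" using assms by (simp add: top_word_def words_def)
  then have "top_word n \<in> {y \<in> words n. \<tau> n x < \<tau> n y}"
    using \<tau> assms universal_weight_less_top_word unfolding universal_statistic_def by blast
  then show ?thesis unfolding stat_rank_def by (auto simp: card_gt_0_iff)
qed

text \<open>Every word ranked above \<open>x\<close> has at least the weight of \<open>x\<close>, so
  these words together weigh at most the total mass.\<close>

lemma rank_mult_universal_weight:
  assumes x: "x \<in> words n"
  shows "real (stat_rank \<tau> n x) * universal_weight n x \<le> 2 * real n + 1"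
proof -
  let ?S = "{y \<in> words n. \<tau> n x < \<tau> n y}"
  have "real (stat_rank \<tau> n x) * universal_weight n x = (\<Sum>y\<in>?S. universal_weight n x)"
    by (simp add: stat_rank_def)
  also have "\<dots> \<le> (\<Sum>y\<in>?S. universal_weight n y)"
  proof (rule sum_mono)
    fix y assume "y \<in> ?S"
    then show "universal_weight n x \<le> universal_weight n y"
      using \<tau> x unfolding universal_statistic_def by (metis (no_types, lifting) mem_Collect_eq not_less order.asym)
  qed
  also have "\<dots> \<le> (\<Sum>y\<in>words n. universal_weight n y)"
    by (intro sum_mono2) (auto simp: universal_weight_nonneg)
  also have "\<dots> \<le> 2 * real n + 1" by (rule sum_universal_weight)
  finally show ?thesis .
qed

end

section \<open>Almost sure growth of the rank\<close>

context ergodic_source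
begin

text \<open>A table of nearly minimal loss has some index \<open>j\<close>; for \<open>n > j\<close>
  its probability is part of the weight, so the rank times this probability is at most
  \<open>2 * n + 1\<close>.\<close>

lemma rank_eventually_upper:
  assumes \<tau>: "universal_statistic \<tau>" and c: "min_loss < c"
  shows "AE \<omega> in M. \<forall>\<^sub>F n in sequentially. 0 < stat_rank \<tau> n (prefix n \<omega>) \<longrightarrow>
    log 2 (stat_rank \<tau> n (prefix n \<omega>)) \<le> c * real n"
proof -
  define c' where "c' = (min_loss + c) / 2"
  have c': "min_loss < c'" "c' < c" using c by (auto simp: c'_def)
  obtain k l where kl: "mean_loss k l < c'" using c'(1) by (rule min_loss_less)
  define j where "j = to_nat (k, l)"
  have j: "coded_markov_prob j = markov_prob k l" by (simp add: coded_markov_prob_def j_def)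
  have "(\<lambda>n. log 2 (2 * real n + 1) / real n) \<longlonglongrightarrow> 0" by real_asymp
  then have small: "\<forall>\<^sub>F n in sequentially. log 2 (2 * real n + 1) / real n < c - c'"
    using c' by (intro order_tendstoD(2)) auto
  show ?thesis
    using markov_prob_eventually_ge[OF kl]
  proof eventually_elim
    case (elim \<omega>)
    then show ?case using small eventually_gt_at_top[of j]
    proof eventually_elim
      case (elim n)
      let ?x = "prefix n \<omega>"
      show ?case
      proof
        assume r: "0 < stat_rank \<tau> n ?x"
        have "real (stat_rank \<tau> n ?x) * markov_prob k l ?x \<le> real (stat_rank \<tau> n ?x) * universal_weight n ?x"
          using coded_markov_prob_le_universal_weight[OF elim(3), of ?x] by (simp add: j mult_left_mono)
        also have "\<dots> \<le> 2 * real n + 1" by (intro rank_mult_universal_weight \<tau> prefix_in_words)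
        finally have "log 2 (real (stat_rank \<tau> n ?x) * markov_prob k l ?x) \<le> log 2 (2 * real n + 1)"
          using r markov_prob_pos by (subst log_le_cancel_iff) auto
        then have "log 2 (stat_rank \<tau> n ?x) + log 2 (markov_prob k l ?x) \<le> log 2 (2 * real n + 1)"
          using r markov_prob_pos[of k l ?x] by (simp add: log_mult_pos)
        moreover have "log 2 (2 * real n + 1) < (c - c') * real n"
          using elim(2,3) by (simp add: pos_divide_less_eq)
        ultimately show "log 2 (stat_rank \<tau> n ?x) \<le> c * real n"
          using elim(1) by (simp add: algebra_simps)
      qed
    qed
  qed
qed

text \<open>At most \<open>2 powr (c * n)\<close> words have a positive number below that bound.
  Eventually the prefix has probability below \<open>2 powr - (c' * n)\<close>, and such words among
  them have summable total probability, so Borel-Cantelli applies.\<close>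

lemma injective_code_eventually_lower:
  fixes N :: "nat \<Rightarrow> bool list \<Rightarrow> nat"
  assumes inj: "\<And>n. inj_on (N n) (words n)" and c: "c < min_loss"
  shows "AE \<omega> in M. \<forall>\<^sub>F n in sequentially. 0 < N n (prefix n \<omega>) \<longrightarrow>
    c * real n \<le> log 2 (N n (prefix n \<omega>))"
proof -
  define c' where "c' = (min_loss + c) / 2"
  have c': "c < c'" "c' < min_loss" using c by (auto simp: c'_def)
  \<comment> \<open>The words that violate the claim although their probability is already
    small.\<close>
  define W where "W = (\<lambda>n. {x \<in> words n. 0 < N n x \<and> real (N n x) < 2 powr (c * real n) \<and>
    word_prob M x < 2 powr - (c' * real n)})"
  define A where "A = (\<lambda>n. {\<omega> \<in> space M. prefix n \<omega> \<in> W n})"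
  have [measurable]: "A n \<in> sets M" for n unfolding A_def by measurable
  have W_words: "W n \<subseteq> words n" for n by (auto simp: W_def)
  have card_W: "real (card (W n)) \<le> 2 powr (c * real n)" for n
  proof -
    have "N n ` W n \<subseteq> {1..nat \<lfloor>2 powr (c * real n)\<rfloor>}"
      by (auto simp: W_def le_nat_floor)
    then have "card (N n ` W n) \<le> nat \<lfloor>2 powr (c * real n)\<rfloor>"
      using card_mono[of "{1..nat \<lfloor>2 powr (c * real n)\<rfloor>}"] by fastforce
    moreover have "card (N n ` W n) = card (W n)"
      by (rule card_image[OF inj_on_subset[OF inj W_words]])
    ultimately have "real (card (W n)) \<le> real (nat \<lfloor>2 powr (c * real n)\<rfloor>)"
      by (simp only: of_nat_le_iff)
    also have "\<dots> \<le> 2 powr (c * real n)" by (rule of_nat_floor) simp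
    finally show ?thesis .
  qed
  have "measure M (A n) \<le> (2 powr - (c' - c)) ^ n" for n
  proof -
    have "measure M (A n) = (\<integral>\<omega>. indicator (A n) \<omega> \<partial>M)" by simp
    also have "\<dots> = (\<integral>\<omega>. indicator (W n) (prefix n \<omega>) \<partial>M)"
      by (intro Bochner_Integration.integral_cong) (auto simp: A_def indicator_def)
    also have "\<dots> = (\<Sum>x\<in>words n. word_prob M x * indicator (W n) x)" by (rule integral_prefix)
    also have "\<dots> = (\<Sum>x\<in>W n. word_prob M x)"
      using W_words[of n] by (intro sum.mono_neutral_cong_right) auto
    also have "\<dots> \<le> real (card (W n)) * 2 powr - (c' * real n)"
      by (rule sum_bounded_above) (auto simp: W_def)
    also have "\<dots> \<le> 2 powr (c * real n) * 2 powr - (c' * real n)"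
      by (intro mult_right_mono card_W) auto
    also have "\<dots> = (2 powr - (c' - c)) ^ n"
      by (simp add: powr_power flip: powr_add add: algebra_simps)
    finally show ?thesis .
  qed
  note bound = this
  have "summable (\<lambda>n. (2 powr - (c' - c)) ^ n)"
    using c' by (intro summable_geometric) (simp add: powr_less_one)
  then have "summable (\<lambda>n. measure M (A n))"
    by (rule summable_comparison_test'[where N = 0]) (use bound in simp)
  then have "AE \<omega> in M. \<forall>\<^sub>F n in sequentially. \<omega> \<in> space M - A n"
    by (intro borel_cantelli_AE1) (auto simp: less_top[symmetric])
  moreover have "AE \<omega> in M. \<forall>\<^sub>F n in sequentially. word_prob M (prefix n \<omega>) < 2 powr - (c' * real n)"
    using min_loss_le_block_entropy c'(2) by (rule word_prob_eventually_less)
  ultimately show ?thesis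
  proof eventually_elim
    case (elim \<omega>)
    then show ?case
    proof eventually_elim
      case (elim n)
      show ?case
      proof
        assume N: "0 < N n (prefix n \<omega>)"
        with elim have "2 powr (c * real n) \<le> real (N n (prefix n \<omega>))"
          by (auto simp: A_def W_def not_less)
        with N show "c * real n \<le> log 2 (N n (prefix n \<omega>))" by (simp add: le_log_iff)
      qed
    qed
  qed
qed

lemma pval_exponent:
  assumes \<tau>: "universal_statistic \<tau>"
  shows "AE \<omega> in M. (\<lambda>n. - (1 / real n) * log 2 (pval \<tau> (prefix n \<omega>)))
    \<longlonglongrightarrow> 1 - entropy_rate M"
proof -
  \<comment> \<open>Rational bounds, so that one null set serves all of them.\<close>
  have "AE \<omega> in M. \<forall>c::rat. of_rat c < min_loss \<longrightarrow> (\<forall>\<^sub>F n in sequentially.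
      0 < stat_rank \<tau> n (prefix n \<omega>) \<longrightarrow> of_rat c * real n \<le> log 2 (stat_rank \<tau> n (prefix n \<omega>)))"
    using injective_code_eventually_lower[of "stat_rank \<tau>"] inj_on_rank[OF \<tau>]
    by (simp add: AE_all_countable)
  moreover have "AE \<omega> in M. \<forall>c::rat. min_loss < of_rat c \<longrightarrow> (\<forall>\<^sub>F n in sequentially.
      0 < stat_rank \<tau> n (prefix n \<omega>) \<longrightarrow> log 2 (stat_rank \<tau> n (prefix n \<omega>)) \<le> of_rat c * real n)"
    using rank_eventually_upper[OF \<tau>] by (simp add: AE_all_countable)
  ultimately show ?thesis
  proof eventually_elim
    case (elim \<omega>)
    \<comment> \<open>Without a positive rank the bounds above are vacuous and the logarithm takes
      its default value.\<close>
    have pos: "\<forall>\<^sub>F n in sequentially. 0 < n \<and> 0 < stat_rank \<tau> n (prefix n \<omega>)"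
      using eventually_prefix_neq_top_word[of \<omega>] eventually_gt_at_top[of 0]
      by eventually_elim (simp add: rank_pos[OF \<tau>])
    have "(\<lambda>n. log 2 (stat_rank \<tau> n (prefix n \<omega>)) / real n) \<longlonglongrightarrow> min_loss"
    proof (rule order_tendstoI)
      fix a assume "a < min_loss"
      then obtain c where c: "a < of_rat c" "of_rat c < min_loss" using of_rat_dense by blast
      with elim(1) have "\<forall>\<^sub>F n in sequentially. 0 < stat_rank \<tau> n (prefix n \<omega>) \<longrightarrow>
          of_rat c * real n \<le> log 2 (stat_rank \<tau> n (prefix n \<omega>))" by blast
      with pos show "\<forall>\<^sub>F n in sequentially. a < log 2 (stat_rank \<tau> n (prefix n \<omega>)) / real n"
      proof eventually_elim
        case (elim n)
        then have "of_rat c \<le> log 2 (stat_rank \<tau> n (prefix n \<omega>)) / real n" by (simp add: pos_le_divide_eq)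
        with c show ?case by simp
      qed
    next
      fix a assume "min_loss < a"
      then obtain c where c: "min_loss < of_rat c" "of_rat c < a" using of_rat_dense by blast
      with elim(2) have "\<forall>\<^sub>F n in sequentially. 0 < stat_rank \<tau> n (prefix n \<omega>) \<longrightarrow>
          log 2 (stat_rank \<tau> n (prefix n \<omega>)) \<le> of_rat c * real n" by blast
      with pos show "\<forall>\<^sub>F n in sequentially. log 2 (stat_rank \<tau> n (prefix n \<omega>)) / real n < a"
      proof eventually_elim
        case (elim n)
        then have "log 2 (stat_rank \<tau> n (prefix n \<omega>)) / real n \<le> of_rat c" by (simp add: pos_divide_le_eq)
        with c show ?case by simp
      qed
    qed
    then have "(\<lambda>n. 1 - log 2 (stat_rank \<tau> n (prefix n \<omega>)) / real n) \<longlonglongrightarrow> 1 - entropy_rate M"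
      unfolding entropy_rate_eq_min_loss by (intro tendsto_intros)
    moreover have "\<forall>\<^sub>F n in sequentially. 1 - log 2 (stat_rank \<tau> n (prefix n \<omega>)) / real n
        = - (1 / real n) * log 2 (pval \<tau> (prefix n \<omega>))"
      using pos
    proof eventually_elim
      case (elim n)
      then have log_eq: "log 2 (pval \<tau> (prefix n \<omega>)) = log 2 (stat_rank \<tau> n (prefix n \<omega>)) - real n"
        by (simp add: pval_eq_rank[of _ n] log_divide_pos log_nat_power)
      show ?case unfolding log_eq using elim by (simp add: field_simps)
    qed
    ultimately show ?case by (rule Lim_transform_eventually)
  qed
qed

end

theorem theorem1:
  shows "\<exists>\<tau> :: nat \<Rightarrow> bool list \<Rightarrow> real.
    \<forall>M :: (nat \<Rightarrow> bool) measure. stationary M \<and> ergodic M \<longrightarrow>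
      (AE \<omega> in M. (\<lambda>n. - (1 / real n) * log 2 (pval \<tau> (prefix n \<omega>)))
                     \<longlonglongrightarrow> 1 - entropy_rate M)"
proof -
  obtain \<tau> where "universal_statistic \<tau>" using exists_universal_statistic by blast
  then show ?thesis
    using ergodic_source.pval_exponent unfolding ergodic_source_def by blast
qed

end
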